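(* Let $n\ge 3$ be an odd integer. The resolving polynomial of $\Delta(SD_{8n})$ is \[\beta(\Delta(SD_{8n}),x)=x^{8n}+8n\,x^{8n-1}+2^{2n+4}(n-1)x^{7n-2}+\sum_{i=7n-1}^{8n-2}r_i x^i,\] where \[r_i=2^{16n-2i}\left\{\binom{n+1}{8n-i}+(n-1)\binom{n+1}{8n-i-1}\right\}\quad\text{for } 7n-1\le i\le 8n-2.\]
   Context: For an integer $n\ge 2$, the semidihedral group is $SD_{8n}=\langle a,b : a^{4n}=b^2=e,\ ba=a^{2n-1}b\rangle$, a group of order $8n$. The commuting graph $\Delta(G)$ of a group $G$ is the simple graph with vertex set $G$ in which two distinct vertices $x,y$ are adjacent iff $xy=yx$. A vertex $z$ of a connected graph $\Gamma$ resolves vertices $u,v$ if $d(z,u)\ne d(z,v)$, where $d$ is the graph distance. A set $U$ of vertices is a resolving set if every pair of distinct vertices is resolved by some vertex of $U$. The metric dimension $\dim(\Gamma)$ is the least cardinality of a resolving set. The resolving polynomial of a graph $\Gamma$ of order $N$ is $\beta(\Gamma,x)=\sum_{i=\dim(\Gamma)}^{N} r_i x^i$, where $r_i$ is the number of resolving sets of $\Gamma$ of cardinality $i$. *)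

theory Defs
  imports
    "HOL-Algebra.Group"
    "HOL-Computational_Algebra.Polynomial"
    "Graph_Theory.Graph_Theory"
begin

section \<open>Groups given by generators and relations\<close>

text \<open>
  The generators are the elements of the type \<open>'g\<close>. The letter \<open>(x, True)\<close> stands for the
  generator \<open>x\<close>, and \<open>(x, False)\<close> for its inverse. A relation \<open>(l, r)\<close> is read as the
  equation \<open>l = r\<close>.
\<close>

type_synonym 'g word = "('g \<times> bool) list"

inductive word_eq :: "('g word \<times> 'g word) set \<Rightarrow> 'g word \<Rightarrow> 'g word \<Rightarrow> bool"
  for R :: "('g word \<times> 'g word) set" where
  refl: "word_eq R w w"
| sym: "word_eq R v w \<Longrightarrow> word_eq R w v"
| trans: "word_eq R u v \<Longrightarrow> word_eq R v w \<Longrightarrow> word_eq R u w"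
| cancel: "word_eq R (u @ [(x, s), (x, \<not> s)] @ v) (u @ v)"
| relation: "(l, r) \<in> R \<Longrightarrow> word_eq R (u @ l @ v) (u @ r @ v)"

definition word_class :: "('g word \<times> 'g word) set \<Rightarrow> 'g word \<Rightarrow> 'g word set" where
  "word_class R w = {v. word_eq R w v}"

definition presented_group :: "('g word \<times> 'g word) set \<Rightarrow> 'g word set monoid" where
  "presented_group R =
    \<lparr> carrier = range (word_class R),
      monoid.mult = (\<lambda>X Y. \<Union>x\<in>X. \<Union>y\<in>Y. word_class R (x @ y)),
      one = word_class R [] \<rparr>"

lemma word_class_eq_iff: "word_class R v = word_class R w \<longleftrightarrow> word_eq R v w"
proof
  assume "word_class R v = word_class R w"
  moreover have "w \<in> word_class R w"
    by (simp add: word_class_def word_eq.refl)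
  ultimately show "word_eq R v w"
    by (simp add: word_class_def set_eq_iff)
next
  assume vw: "word_eq R v w"
  show "word_class R v = word_class R w"
    using word_eq.trans[OF vw] word_eq.trans[OF word_eq.sym[OF vw]]
    by (force simp only: word_class_def)
qed

lemma word_eq_context: "word_eq R v w \<Longrightarrow> word_eq R (p @ v @ q) (p @ w @ q)"
proof (induction rule: word_eq.induct)
  case (refl w)
  show ?case by (rule word_eq.refl)
next
  case (sym v w)
  show ?case by (rule word_eq.sym) fact
next
  case (trans u v w)
  show ?case by (rule word_eq.trans) fact+
next
  case (cancel u x s v)
  show ?case using word_eq.cancel[of R "p @ u" x s "v @ q"] by simp
next
  case (relation l r u v)
  then show ?case using word_eq.relation[of l r R "p @ u" "v @ q"] by simp
qed

lemma word_eq_append: "word_eq R v v' \<Longrightarrow> word_eq R w w' \<Longrightarrow> word_eq R (v @ w) (v' @ w')"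
  using word_eq_context[of R v v' "[]" w] word_eq_context[of R w w' v' "[]"]
    word_eq.trans[of R "v @ w" "v' @ w" "v' @ w'"]
  by simp

lemma mult_word_class:
  "word_class R v \<otimes>\<^bsub>presented_group R\<^esub> word_class R w = word_class R (v @ w)"
proof -
  have "word_class R (x @ y) = word_class R (v @ w)"
    if "x \<in> word_class R v" "y \<in> word_class R w" for x y
  proof -
    have "word_eq R v x" "word_eq R w y"
      using that by (simp_all add: word_class_def)
    then have "word_eq R (v @ w) (x @ y)"
      by (rule word_eq_append)
    then show ?thesis
      unfolding word_class_eq_iff by (rule word_eq.sym)
  qed
  then have "(\<Union>x\<in>word_class R v. \<Union>y\<in>word_class R w. word_class R (x @ y)) =
      (\<Union>x\<in>word_class R v. \<Union>y\<in>word_class R w. word_class R (v @ w))"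
    by (intro SUP_cong HOL.refl) simp_all
  moreover have "v \<in> word_class R v" "w \<in> word_class R w"
    by (simp_all add: word_class_def word_eq.refl)
  ultimately show ?thesis
    unfolding presented_group_def by auto
qed

lemma word_eq_inverse: "word_eq R (map (\<lambda>(x, s). (x, \<not> s)) (rev w) @ w) []"
proof (induction w)
  case (Cons l w)
  obtain x s where l: "l = (x, s)" by force
  have "word_eq R (map (\<lambda>(x, s). (x, \<not> s)) (rev w) @ [(x, \<not> s), (x, \<not> \<not> s)] @ w)
      (map (\<lambda>(x, s). (x, \<not> s)) (rev w) @ w)"
    by (rule word_eq.cancel)
  from word_eq.trans[OF this Cons] show ?case by (simp add: l)
qed (simp add: word_eq.refl)

lemma group_presented_group: "group (presented_group R)"
proof (rule groupI)
  fix X assume "X \<in> carrier (presented_group R)"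
  then obtain w where "X = word_class R w" by (auto simp: presented_group_def)
  then have "word_class R (map (\<lambda>(x, s). (x, \<not> s)) (rev w)) \<otimes>\<^bsub>presented_group R\<^esub> X
      = \<one>\<^bsub>presented_group R\<^esub>"
    using word_eq_inverse[of R w]
    by (simp add: mult_word_class word_class_eq_iff) (simp add: presented_group_def word_class_eq_iff)
  then show "\<exists>Y\<in>carrier (presented_group R). Y \<otimes>\<^bsub>presented_group R\<^esub> X = \<one>\<^bsub>presented_group R\<^esub>"
    by (auto simp: presented_group_def)
next
  have c: "carrier (presented_group R) = range (word_class R)"
    and o: "\<one>\<^bsub>presented_group R\<^esub> = word_class R []"
    by (simp_all add: presented_group_def)
  fix X Y Z
  show "\<one>\<^bsub>presented_group R\<^esub> \<in> carrier (presented_group R)"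
    by (simp add: c o)
  assume X: "X \<in> carrier (presented_group R)"
  then show "\<one>\<^bsub>presented_group R\<^esub> \<otimes>\<^bsub>presented_group R\<^esub> X = X"
    by (auto simp: c o mult_word_class)
  assume Y: "Y \<in> carrier (presented_group R)"
  with X show "X \<otimes>\<^bsub>presented_group R\<^esub> Y \<in> carrier (presented_group R)"
    by (auto simp: c mult_word_class)
  assume "Z \<in> carrier (presented_group R)"
  with X Y show "X \<otimes>\<^bsub>presented_group R\<^esub> Y \<otimes>\<^bsub>presented_group R\<^esub> Z =
      X \<otimes>\<^bsub>presented_group R\<^esub> (Y \<otimes>\<^bsub>presented_group R\<^esub> Z)"
    by (auto simp: c mult_word_class)
qed

section \<open>The semidihedral group of order \<open>8n\<close>\<close>

datatype sd_gen = gen_a | gen_b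

definition semidihedral_relations :: "nat \<Rightarrow> (sd_gen word \<times> sd_gen word) set" where
  "semidihedral_relations n =
    (let a = (gen_a, True); b = (gen_b, True) in
      {(replicate (4 * n) a, []), ([b, b], []), ([b, a], replicate (2 * n - 1) a @ [b])})"

definition semidihedral_group :: "nat \<Rightarrow> sd_gen word set monoid" where
  "semidihedral_group n = presented_group (semidihedral_relations n)"

section \<open>Commuting graphs\<close>

text \<open>
  A simple graph is represented by the digraph that has the arcs \<open>(x, y)\<close> and \<open>(y, x)\<close>
  for every edge \<open>xy\<close>.
\<close>

definition commuting_graph :: "('a, 'b) monoid_scheme \<Rightarrow> 'a pair_pre_digraph" where
  "commuting_graph G =
    \<lparr> pverts = carrier G,
      parcs = {(x, y). x \<in> carrier G \<and> y \<in> carrier G \<and> x \<noteq> y \<and>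
                 x \<otimes>\<^bsub>G\<^esub> y = y \<otimes>\<^bsub>G\<^esub> x} \<rparr>"

lemma pair_bidirected_commuting_graph: "pair_bidirected_digraph (commuting_graph G)"
  by unfold_locales (auto simp: commuting_graph_def symmetric_def intro!: symI)

section \<open>Resolving sets\<close>

text \<open>With unit arc costs, \<open>\<mu>\<close> is the least number of arcs of a walk.\<close>

definition graph_dist :: "'a pair_pre_digraph \<Rightarrow> 'a \<Rightarrow> 'a \<Rightarrow> ereal" where
  "graph_dist \<Gamma> u v = wf_digraph.\<mu> (with_proj \<Gamma>) (\<lambda>_. 1) u v"

definition resolves :: "'a pair_pre_digraph \<Rightarrow> 'a \<Rightarrow> 'a \<Rightarrow> 'a \<Rightarrow> bool" where
  "resolves \<Gamma> z u v \<longleftrightarrow> graph_dist \<Gamma> z u \<noteq> graph_dist \<Gamma> z v"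

definition resolving_set :: "'a pair_pre_digraph \<Rightarrow> 'a set \<Rightarrow> bool" where
  "resolving_set \<Gamma> U \<longleftrightarrow> U \<subseteq> pverts \<Gamma> \<and>
    (\<forall>u\<in>pverts \<Gamma>. \<forall>v\<in>pverts \<Gamma>. u \<noteq> v \<longrightarrow> (\<exists>z\<in>U. resolves \<Gamma> z u v))"

text \<open>The remaining notions are meant for finite graphs.\<close>

definition metric_dimension :: "'a pair_pre_digraph \<Rightarrow> nat" where
  "metric_dimension \<Gamma> = (LEAST k. \<exists>U. resolving_set \<Gamma> U \<and> finite U \<and> card U = k)"

definition resolving_count :: "'a pair_pre_digraph \<Rightarrow> nat \<Rightarrow> nat" where
  "resolving_count \<Gamma> i = card {U. resolving_set \<Gamma> U \<and> finite U \<and> card U = i}"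

definition resolving_polynomial :: "'a pair_pre_digraph \<Rightarrow> int poly" where
  "resolving_polynomial \<Gamma> =
    (\<Sum>i = metric_dimension \<Gamma>..card (pverts \<Gamma>). monom (int (resolving_count \<Gamma> i)) i)"

end

theory Submission
  imports Defs "HOL-Number_Theory.Cong"
begin

text \<open>
  For odd \<open>n\<close> the center of \<open>SD\<^bsub>8n\<^esub>\<close> is \<open>\<langle>a^n\<rangle>\<close>, of order 4. A noncentral power of \<open>a\<close> has
  centralizer \<open>\<langle>a\<rangle>\<close>, and \<open>a^i b\<close> has as centralizer the union of the center and its coset by
  \<open>a^i b\<close>. So the vertices fall into \<open>n + 2\<close> classes of twins, of sizes \<open>4\<close> (the center),
  \<open>4(n - 1)\<close> and \<open>n\<close> times \<open>4\<close>, and all distances are at most 2. Two twins are resolved only by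
  themselves, while vertices of different classes are resolved by any set that meets every class.
  Hence a set is resolving iff its complement meets each class at most once, and the sets with
  complements of size \<open>k\<close> are counted by the coefficient of \<open>y^k\<close> in
  \<open>(1 + 4y)^(n + 1) (1 + 4(n - 1)y)\<close>.
\<close>

section \<open>Distances in commuting graphs\<close>

text \<open>Distances are infima of walk costs over all walks; with unit costs a shortest walk
  attains the infimum.\<close>

lemma graph_dist_eqI:
  assumes "pair_bidirected_digraph \<Gamma>"
    and "pre_digraph.awalk (with_proj \<Gamma>) u p v"
    and "\<And>q. pre_digraph.awalk (with_proj \<Gamma>) u q v \<Longrightarrow> length p \<le> length q"
  shows "graph_dist \<Gamma> u v = real (length p)"
proof -
  interpret pair_bidirected_digraph \<Gamma> by fact
  have cost: "awalk_cost (\<lambda>_. 1) q = real (length q)" for q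
    by (induction q) simp_all
  show ?thesis
    unfolding graph_dist_def \<mu>_def cost
    using assms(2,3) by (intro INF_eqI) auto
qed

text \<open>A central element \<open>z\<close> is joined to every other vertex, so two elements that
  do not commute are still linked by the walk through \<open>z\<close>.\<close>

lemma graph_dist_commuting_graph:
  assumes z: "z \<in> carrier G" "\<And>x. x \<in> carrier G \<Longrightarrow> x \<otimes>\<^bsub>G\<^esub> z = z \<otimes>\<^bsub>G\<^esub> x"
    and u: "u \<in> carrier G" and v: "v \<in> carrier G"
  shows "graph_dist (commuting_graph G) u v =
    (if u = v then 0 else if u \<otimes>\<^bsub>G\<^esub> v = v \<otimes>\<^bsub>G\<^esub> u then 1 else 2)"
proof -
  let ?\<Gamma> = "commuting_graph G"
  note pb = pair_bidirected_commuting_graph[of G]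
  interpret pair_bidirected_digraph ?\<Gamma> by (rule pb)
  have V: "pverts ?\<Gamma> = carrier G"
    and E: "(x, y) \<in> parcs ?\<Gamma> \<longleftrightarrow> x \<in> carrier G \<and> y \<in> carrier G \<and> x \<noteq> y \<and>
      x \<otimes>\<^bsub>G\<^esub> y = y \<otimes>\<^bsub>G\<^esub> x" for x y
    by (auto simp: commuting_graph_def)
  have Nil: "awalk u [] v \<longleftrightarrow> u = v"
    using u by (auto simp: awalk_def V)
  have One: "awalk u [e] v \<longleftrightarrow> e = (u, v) \<and> (u, v) \<in> parcs ?\<Gamma>" for e
    using u by (cases e) (auto simp: awalk_def V)
  consider "u = v" | "u \<noteq> v" "u \<otimes>\<^bsub>G\<^esub> v = v \<otimes>\<^bsub>G\<^esub> u" | "u \<otimes>\<^bsub>G\<^esub> v \<noteq> v \<otimes>\<^bsub>G\<^esub> u"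
    by blast
  then show ?thesis
  proof cases
    case 1
    then show ?thesis using Nil graph_dist_eqI[OF pb, of u "[]" v] by simp
  next
    case 2
    have "length [(u, v)] \<le> length q" if "awalk u q v" for q
      using that 2 Nil by (cases q) auto
    moreover have "awalk u [(u, v)] v" using 2 u v One E by simp
    ultimately have "graph_dist ?\<Gamma> u v = real (length [(u, v)])"
      by (intro graph_dist_eqI[OF pb])
    then show ?thesis using 2 by simp
  next
    case 3
    have "length [(u, z), (z, v)] \<le> length q" if q: "awalk u q v" for q
    proof -
      have "q \<noteq> []" using q 3 Nil by auto
      moreover have "q \<noteq> [e]" for e using q 3 One E by blast
      ultimately show ?thesis by (cases q; cases "tl q") auto
    qed
    moreover have "awalk u [(u, z), (z, v)] v"
      using u v z 3 z(2)[of u] z(2)[of v] by (auto simp: awalk_def V E)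
    ultimately have "graph_dist ?\<Gamma> u v = real (length [(u, z), (z, v)])"
      by (intro graph_dist_eqI[OF pb])
    then show ?thesis using 3 by auto
  qed
qed

section \<open>Counting partial transversals\<close>

text \<open>Group the sets \<open>W\<close> by their image \<open>S\<close>. Those with image
  \<open>S\<close> are the ways of choosing one point in each fibre over \<open>S\<close>, hence the
  product of fibre sizes.\<close>

lemma card_subsets_inj_on:
  assumes "finite A"
  shows "card {W. W \<subseteq> A \<and> inj_on f W \<and> card W = k} =
    (\<Sum>S | S \<subseteq> f ` A \<and> card S = k. \<Prod>y\<in>S. card {x \<in> A. f x = y})"
proof -
  let ?P = "\<lambda>S. {W. W \<subseteq> A \<and> bij_betw f W S}"
  have "card (?P S) = (\<Prod>y\<in>S. card {x \<in> A. f x = y})" if S: "finite S" for S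
  proof -
    let ?F = "\<Pi>\<^sub>E y\<in>S. {x \<in> A. f x = y}"
    have "bij_betw (\<lambda>g. g ` S) ?F (?P S)"
    \<comment> \<open>The inverse recovers the choice function from its range; it is restricted to
      \<open>S\<close> so that it is extensional, as \<open>PiE\<close> demands.\<close>
    proof (rule bij_betw_byWitness[where f' = "\<lambda>W. \<lambda>y\<in>S. inv_into W f y"])
      show "\<forall>g\<in>?F. (\<lambda>y\<in>S. inv_into (g ` S) f y) = g"
      proof
        fix g assume g: "g \<in> ?F"
        then have fg: "f (g y) = y" if "y \<in> S" for y using that by (auto simp: PiE_iff)
        show "(\<lambda>y\<in>S. inv_into (g ` S) f y) = g"
        proof
          fix y show "(\<lambda>y\<in>S. inv_into (g ` S) f y) y = g y"
          proof (cases "y \<in> S")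
            case True
            have "inj_on f (g ` S)" by (rule inj_onI) (auto simp: fg)
            with True show ?thesis by (simp add: inv_into_f_eq fg)
          next
            case False with g show ?thesis by (auto simp: PiE_iff extensional_def)
          qed
        qed
      qed
      show "\<forall>W\<in>?P S. (\<lambda>y\<in>S. inv_into W f y) ` S = W"
        by (force simp: bij_betw_def)
      show "(\<lambda>g. g ` S) ` ?F \<subseteq> ?P S"
      proof clarsimp
        fix g assume g: "g \<in> ?F"
        then have fg: "f (g y) = y" "g y \<in> A" if "y \<in> S" for y using that by (auto simp: PiE_iff)
        have "inj_on f (g ` S)" by (rule inj_onI) (auto simp: fg)
        moreover have "f ` g ` S = S" by (force simp: fg)
        ultimately show "g ` S \<subseteq> A \<and> bij_betw f (g ` S) S"
          by (auto simp: bij_betw_def fg)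
      qed
      show "(\<lambda>W. \<lambda>y\<in>S. inv_into W f y) ` ?P S \<subseteq> ?F"
      proof clarsimp
        fix W y assume W: "W \<subseteq> A" "bij_betw f W S" and y: "y \<in> S"
        then have "y \<in> f ` W" by (simp add: bij_betw_def)
        with W show "inv_into W f y \<in> A \<and> f (inv_into W f y) = y"
          by (metis f_inv_into_f inv_into_into subsetD)
      qed
    qed
    then have "card (?P S) = card ?F" by (simp add: bij_betw_same_card)
    then show ?thesis using S by (simp add: card_PiE)
  qed
  moreover have "finite S" if "S \<subseteq> f ` A" for S
    using that assms finite_subset by blast
  ultimately have "(\<Sum>S | S \<subseteq> f ` A \<and> card S = k. \<Prod>y\<in>S. card {x \<in> A. f x = y}) =
      (\<Sum>S | S \<subseteq> f ` A \<and> card S = k. card (?P S))"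
    by (intro sum.cong) auto
  also have "\<dots> = card (\<Union>S\<in>{S. S \<subseteq> f ` A \<and> card S = k}. ?P S)"
    using assms by (intro card_UN_disjoint[symmetric]) (auto simp: bij_betw_def)
  also have "(\<Union>S\<in>{S. S \<subseteq> f ` A \<and> card S = k}. ?P S) = {W. W \<subseteq> A \<and> inj_on f W \<and> card W = k}"
    by (auto simp: bij_betw_def card_image image_mono)
  finally show ?thesis by simp
qed

text \<open>This is the coefficient of \<open>y^(k+1)\<close> in
  \<open>(1 + c y)^|L| (1 + m(a) y)\<close>, found by splitting the sets \<open>S\<close> according
  to whether they contain the exceptional index \<open>a\<close>.\<close>

lemma sum_prod_subsets_Suc:
  fixes m :: "'a \<Rightarrow> 'b :: comm_semiring_1"
  assumes L: "finite L" "a \<notin> L" and m: "\<And>l. l \<in> L \<Longrightarrow> m l = c"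
  shows "(\<Sum>S | S \<subseteq> insert a L \<and> card S = Suc k. \<Prod>l\<in>S. m l) =
    c ^ Suc k * of_nat (card L choose Suc k) + m a * c ^ k * of_nat (card L choose k)"
proof -
  have prod: "(\<Prod>l\<in>S. m l) = c ^ card S" if "S \<subseteq> L" for S
    using that m by (simp add: subset_iff)
  let ?P = "\<lambda>j. {S. S \<subseteq> L \<and> card S = j}"
  have fin: "finite (?P j)" for j using L by simp
  have split: "{S. S \<subseteq> insert a L \<and> card S = Suc k} = ?P (Suc k) \<union> insert a ` ?P k"
  proof (intro equalityI subsetI)
    fix S assume S: "S \<in> {S. S \<subseteq> insert a L \<and> card S = Suc k}"
    show "S \<in> ?P (Suc k) \<union> insert a ` ?P k"
    proof (cases "a \<in> S")
      case True
      then have "S = insert a (S - {a})" "S - {a} \<in> ?P k" using S by auto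
      then show ?thesis by blast
    qed (use S in auto)
  next
    fix S assume "S \<in> ?P (Suc k) \<union> insert a ` ?P k"
    then show "S \<in> {S. S \<subseteq> insert a L \<and> card S = Suc k}"
      using L finite_subset[OF _ L(1)] by (auto simp: card_insert_if subset_iff)
  qed
  have inj: "inj_on (insert a) (?P k)"
    using L(2) by (auto simp: inj_on_def)
  have "(\<Sum>S\<in>insert a ` ?P k. \<Prod>l\<in>S. m l) = (\<Sum>S\<in>?P k. m a * c ^ k)"
    unfolding sum.reindex[OF inj] o_def
  proof (intro sum.cong HOL.refl)
    fix S assume "S \<in> ?P k"
    moreover from this have "finite S" "a \<notin> S" using L by (auto dest: finite_subset)
    ultimately show "prod m (insert a S) = m a * c ^ k" by (simp add: prod)
  qed
  moreover have "(\<Sum>S\<in>?P (Suc k). \<Prod>l\<in>S. m l) = (\<Sum>S\<in>?P (Suc k). c ^ Suc k)"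
    by (intro sum.cong) (auto simp: prod)
  moreover have "?P (Suc k) \<inter> insert a ` ?P k = {}" using L by auto
  ultimately show ?thesis
    unfolding split using fin L by (simp add: sum.union_disjoint n_subsets mult_ac)
qed

section \<open>Resolving sets when commuting is decided by classes\<close>

text \<open>
  The class \<open>0\<close> is the center; the other classes, each together with the center, are
  the centralizers of the noncentral elements.
\<close>

locale centralizer_classes =
  fixes G :: "('a, 'b) monoid_scheme" (structure) and \<kappa> :: "'a \<Rightarrow> nat"
  assumes finite_carrier: "finite (carrier G)"
    and commute_iff: "\<lbrakk>x \<in> carrier G; y \<in> carrier G\<rbrakk> \<Longrightarrow>
      x \<otimes> y = y \<otimes> x \<longleftrightarrow> \<kappa> x = 0 \<or> \<kappa> y = 0 \<or> \<kappa> x = \<kappa> y"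
    and central: "0 \<in> \<kappa> ` carrier G"
    and twin: "x \<in> carrier G \<Longrightarrow> \<exists>y\<in>carrier G. y \<noteq> x \<and> \<kappa> y = \<kappa> x"
    and noncentral: "\<exists>x\<in>carrier G. \<kappa> x \<noteq> 0 \<and> \<kappa> x \<noteq> l"
begin

lemma dist: "\<lbrakk>u \<in> carrier G; v \<in> carrier G\<rbrakk> \<Longrightarrow> graph_dist (commuting_graph G) u v =
    (if u = v then 0 else if \<kappa> u = 0 \<or> \<kappa> v = 0 \<or> \<kappa> u = \<kappa> v then 1 else 2)"
proof -
  obtain z where "z \<in> carrier G" "\<kappa> z = 0" using central by auto
  then show "\<lbrakk>u \<in> carrier G; v \<in> carrier G\<rbrakk> \<Longrightarrow> ?thesis"
    using graph_dist_commuting_graph[of z G u v] by (simp add: commute_iff)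
qed

text \<open>Members of one class have equal distances from every third vertex, so one of them must
  lie in \<open>U\<close>. Conversely, a member of \<open>U\<close> resolves itself from anything
  else, and two vertices outside \<open>U\<close> lie in different classes, which representatives in
  \<open>U\<close> tell apart.\<close>

lemma resolving_set_iff:
  "resolving_set (commuting_graph G) U \<longleftrightarrow> U \<subseteq> carrier G \<and> inj_on \<kappa> (carrier G - U)"
proof -
  have V: "pverts (commuting_graph G) = carrier G" by (simp add: commuting_graph_def)
  show ?thesis
  proof (intro iffI conjI)
    assume U: "resolving_set (commuting_graph G) U"
    then show sub: "U \<subseteq> carrier G" by (simp add: resolving_set_def V)
    show "inj_on \<kappa> (carrier G - U)"
    proof (rule inj_onI, rule ccontr)
      fix u v assume uv: "u \<in> carrier G - U" "v \<in> carrier G - U" "\<kappa> u = \<kappa> v" "u \<noteq> v"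
      then obtain z where "z \<in> U" "resolves (commuting_graph G) z u v"
        using U by (metis DiffD1 V resolving_set_def)
      moreover have "z \<in> carrier G" "z \<noteq> u" "z \<noteq> v" using \<open>z \<in> U\<close> uv sub by auto
      ultimately show False using uv by (simp add: resolves_def dist)
    qed
  next
    assume asm: "U \<subseteq> carrier G \<and> inj_on \<kappa> (carrier G - U)"
    then have sub: "U \<subseteq> carrier G" and inj: "inj_on \<kappa> (carrier G - U)" by auto
    \<comment> \<open>\<open>U\<close> meets every class: of \<open>x\<close> and a twin of it, at
      most one is outside \<open>U\<close>.\<close>
    have rep: "\<exists>z\<in>U. \<kappa> z = \<kappa> x" if "x \<in> carrier G" for x
      using twin[OF that] that inj by (metis DiffI inj_on_def)
    \<comment> \<open>As the classes differ, one of them is noncentral, and \<open>v\<close> is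
      taken from it. In both cases \<open>z\<close> is chosen at distance 1 from \<open>u\<close>
      and 2 from \<open>v\<close>: from another noncentral class if \<open>u\<close> is central,
      from the class of \<open>u\<close> otherwise.\<close>
    have res: "\<exists>z\<in>U. resolves (commuting_graph G) z u v"
      if uv: "u \<in> carrier G - U" "v \<in> carrier G - U" "\<kappa> u \<noteq> \<kappa> v" "\<kappa> v \<noteq> 0" for u v
    proof (cases "\<kappa> u = 0")
      case True
      obtain x where "x \<in> carrier G" "\<kappa> x \<noteq> 0" "\<kappa> x \<noteq> \<kappa> v" using noncentral by blast
      then obtain z where z: "z \<in> U" "\<kappa> z \<noteq> 0" "\<kappa> z \<noteq> \<kappa> v" using rep by metis
      moreover have "z \<in> carrier G" "z \<noteq> u" "z \<noteq> v" using z uv sub by auto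
      ultimately have "resolves (commuting_graph G) z u v"
        using True uv by (simp add: resolves_def dist)
      with z show ?thesis by blast
    next
      case False
      obtain z where z: "z \<in> U" "\<kappa> z = \<kappa> u" using rep uv by blast
      moreover have "z \<in> carrier G" "z \<noteq> u" "z \<noteq> v" using z uv sub by auto
      ultimately have "resolves (commuting_graph G) z u v"
        using False uv by (simp add: resolves_def dist)
      with z show ?thesis by blast
    qed
    have "\<exists>z\<in>U. resolves (commuting_graph G) z u v"
      if uv: "u \<in> carrier G" "v \<in> carrier G" "u \<noteq> v" for u v
    proof -
      consider "u \<in> U" | "v \<in> U" | "u \<notin> U" "v \<notin> U" by blast
      then show ?thesis
      proof cases
        case 1 with uv show ?thesis by (auto simp: resolves_def dist split: if_splits intro!: bexI[of _ u])
      next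
        case 2 with uv show ?thesis by (auto simp: resolves_def dist split: if_splits intro!: bexI[of _ v])
      next
        case 3
        with uv inj have "\<kappa> u \<noteq> \<kappa> v" by (auto simp: inj_on_def)
        then show ?thesis using res[of u v] res[of v u] uv 3
          by (metis DiffI resolves_def)
      qed
    qed
    with sub show "resolving_set (commuting_graph G) U" by (simp add: resolving_set_def V)
  qed
qed

text \<open>Complementation turns resolving sets into sets on which the class map is injective,
  which \<open>card_subsets_inj_on\<close> counts.\<close>

lemma resolving_count:
  assumes "k \<le> card (carrier G)"
  shows "resolving_count (commuting_graph G) (card (carrier G) - k) =
    (\<Sum>S | S \<subseteq> \<kappa> ` carrier G \<and> card S = k. \<Prod>l\<in>S. card {x \<in> carrier G. \<kappa> x = l})"
proof -
  let ?C = "carrier G"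
  have "bij_betw (\<lambda>W. ?C - W) {W. W \<subseteq> ?C \<and> inj_on \<kappa> W \<and> card W = k}
      {U. resolving_set (commuting_graph G) U \<and> finite U \<and> card U = card ?C - k}"
    by (rule bij_betw_byWitness[where f' = "\<lambda>W. ?C - W"])
      (auto simp: resolving_set_iff double_diff card_Diff_subset finite_carrier
        finite_subset[OF _ finite_carrier] assms)
  then show ?thesis
    by (simp add: resolving_count_def bij_betw_same_card[symmetric]
        card_subsets_inj_on[OF finite_carrier])
qed

text \<open>The largest complement a resolving set can have is a full transversal of the
  classes.\<close>

lemma metric_dimension:
  "metric_dimension (commuting_graph G) = card (carrier G) - card (\<kappa> ` carrier G)"
  unfolding metric_dimension_def
proof (rule Least_equality)
  let ?C = "carrier G"
  \<comment> \<open>One chosen representative from each class.\<close>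
  let ?W = "inv_into ?C \<kappa> ` \<kappa> ` ?C"
  have W: "?W \<subseteq> ?C" by (auto intro: inv_into_into)
  have "card ?W = card (\<kappa> ` ?C)" by (intro card_image inj_on_inv_into) simp
  then have "card (?C - ?W) = card ?C - card (\<kappa> ` ?C)"
    using W finite_carrier finite_subset by (metis card_Diff_subset)
  moreover have "inj_on \<kappa> ?W" by (auto simp: inj_on_def f_inv_into_f)
  ultimately show "\<exists>U. resolving_set (commuting_graph G) U \<and> finite U \<and>
      card U = card ?C - card (\<kappa> ` ?C)"
    using W finite_carrier by (intro exI[of _ "?C - ?W"]) (simp add: resolving_set_iff double_diff)
next
  fix k assume "\<exists>U. resolving_set (commuting_graph G) U \<and> finite U \<and> card U = k"
  then obtain U where U: "U \<subseteq> carrier G" "inj_on \<kappa> (carrier G - U)" "finite U" "card U = k"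
    by (auto simp: resolving_set_iff)
  then have "card (carrier G) - k = card (\<kappa> ` (carrier G - U))"
    by (simp add: card_image card_Diff_subset)
  also have "\<dots> \<le> card (\<kappa> ` carrier G)"
    using finite_carrier by (intro card_mono) auto
  finally show "card (carrier G) - card (\<kappa> ` carrier G) \<le> k" by simp
qed

end

section \<open>Normal forms in the semidihedral group\<close>

text \<open>
  In the semidihedral group a word \<open>w\<close> evaluates to \<open>a^i b^j\<close>, where \<open>i\<close> is \<open>a_exp n w\<close>
  and \<open>j\<close> is the truth value of \<open>b_odd w\<close>. Moving \<open>b\<close> past \<open>a^i\<close> multiplies \<open>i\<close> by
  \<open>2n - 1\<close>, which is the factor \<open>twist\<close>.
\<close>

fun a_exp :: "nat \<Rightarrow> sd_gen word \<Rightarrow> int" where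
  "a_exp n [] = 0"
| "a_exp n ((gen_a, s) # w) = (if s then 1 else -1) + a_exp n w"
| "a_exp n ((gen_b, s) # w) = (2 * int n - 1) * a_exp n w"

fun b_odd :: "sd_gen word \<Rightarrow> bool" where
  "b_odd [] = False"
| "b_odd ((gen_a, s) # w) = b_odd w"
| "b_odd ((gen_b, s) # w) = (\<not> b_odd w)"

abbreviation twist :: "nat \<Rightarrow> bool \<Rightarrow> int" where
  "twist n t \<equiv> if t then 2 * int n - 1 else 1"

text \<open>Twisting twice is trivial, in agreement with the relation
  \<open>b^2 = e\<close>.\<close>

lemma twist_square: "[(2 * int n - 1) * (2 * int n - 1) = 1] (mod 4 * int n)"
proof -
  have "(2 * int n - 1) * (2 * int n - 1) - 1 = 4 * int n * (int n - 1)"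
    by (simp add: algebra_simps)
  then show ?thesis by (simp add: cong_iff_dvd_diff)
qed

lemma b_odd_append: "b_odd (u @ v) = (b_odd u \<noteq> b_odd v)"
  by (induction u rule: b_odd.induct) auto

text \<open>This is the multiplication law of the semidirect product of the integers mod
  \<open>4n\<close> with a group of order 2 acting by \<open>2n - 1\<close>.\<close>

lemma a_exp_append:
  "[a_exp n (u @ v) = a_exp n u + twist n (b_odd u) * a_exp n v] (mod 4 * int n)"
proof (induction u rule: b_odd.induct)
  case (2 s w)
  from cong_add[OF cong_refl[of "if s then 1 else -1"] this] show ?case by (simp add: add.assoc)
next
  case (3 s w)
  let ?c = "2 * int n - 1"
  have "[?c * a_exp n (w @ v) = ?c * (a_exp n w + twist n (b_odd w) * a_exp n v)] (mod 4 * int n)"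
    using 3 by (rule cong_scalar_left)
  also have "[?c * (a_exp n w + twist n (b_odd w) * a_exp n v) =
      ?c * a_exp n w + twist n (\<not> b_odd w) * a_exp n v] (mod 4 * int n)"
    using cong_scalar_right[OF twist_square, of n "a_exp n v"]
    by (auto simp: distrib_left mult.assoc intro: cong_add)
  finally show ?case by simp
qed simp

lemma a_exp_context:
  assumes "[a_exp n l = a_exp n r] (mod 4 * int n)" "b_odd l = b_odd r"
  shows "[a_exp n (u @ l @ v) = a_exp n (u @ r @ v)] (mod 4 * int n)"
proof -
  have *: "[a_exp n (u @ w @ v) =
      a_exp n u + twist n (b_odd u) * (a_exp n w + twist n (b_odd w) * a_exp n v)] (mod 4 * int n)" for w
    by (rule cong_trans[OF a_exp_append])
      (intro cong_add cong_scalar_left cong_refl a_exp_append)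
  show ?thesis
    using assms by (intro cong_trans[OF * cong_sym[OF cong_trans[OF *]]])
      (auto intro!: cong_add cong_scalar_left dest: cong_sym)
qed

lemma a_exp_replicate: "a_exp n (replicate k (gen_a, True)) = int k"
  and b_odd_replicate: "\<not> b_odd (replicate k (gen_a, True))"
  by (induction k) auto

text \<open>The coordinates are invariants of the word class, since they respect each generating
  rule of \<open>word_eq\<close>. This keeps the presented group from collapsing.\<close>

lemma word_eq_a_exp_b_odd:
  assumes "n > 0" "word_eq (semidihedral_relations n) v w"
  shows "[a_exp n v = a_exp n w] (mod 4 * int n) \<and> b_odd v = b_odd w"
  using assms(2)
proof (induction rule: word_eq.induct)
  case (sym v w)
  then show ?case by (auto dest: cong_sym)
next
  case (trans u v w)
  then show ?case by (auto intro: cong_trans)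
next
  case (cancel u x s v)
  have "[a_exp n [(x, s), (x, \<not> s)] = a_exp n []] (mod 4 * int n)"
    "b_odd [(x, s), (x, \<not> s)] = b_odd []"
    by (cases x; simp)+
  moreover from a_exp_context[OF this, of u v]
  have "[a_exp n (u @ [(x, s), (x, \<not> s)] @ v) = a_exp n (u @ v)] (mod 4 * int n)" by simp
  ultimately show ?case by (simp only: b_odd_append) simp
next
  case (relation l r u v)
  \<comment> \<open>In the three relations the exponents to compare are \<open>4n\<close> and
    \<open>0\<close>, \<open>0\<close> and \<open>0\<close>, and \<open>2n - 1\<close> on both
    sides.\<close>
  have "[a_exp n l = a_exp n r] (mod 4 * int n)" "b_odd l = b_odd r"
    using relation assms(1) a_exp_append[of n "replicate (2 * n - 1) (gen_a, True)" "[(gen_b, True)]"]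
    by (auto simp: semidihedral_relations_def Let_def a_exp_replicate b_odd_append b_odd_replicate
        of_nat_diff cong_def)
  from a_exp_context[OF this, of u v] this(2) show ?case by (simp add: b_odd_append)
qed auto

lemma (in group) int_pow_cong:
  assumes "x \<in> carrier G" "x [^] (m::nat) = \<one>" "[i = j] (mod int m)"
  shows "x [^] (i::int) = x [^] j"
proof -
  from assms(3) obtain k where "i = j + int m * k"
    by (metis cong_iff_lin cong_sym)
  moreover have "x [^] (int m * k) = \<one>"
    using assms by (simp add: int_pow_pow[symmetric] int_pow_int)
  ultimately show ?thesis using assms by (simp add: int_pow_mult)
qed

text \<open>Conjugation by \<open>y\<close> is a homomorphism sending \<open>x\<close> to
  \<open>x^c\<close>. Induction gives nonnegative exponents, and cancelling powers of
  \<open>x\<close> on both sides gives the others.\<close>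

lemma (in group) int_pow_commute_twisted:
  assumes "x \<in> carrier G" "y \<in> carrier G" "y \<otimes> x = x [^] (c::int) \<otimes> y"
  shows "y \<otimes> x [^] (k::int) = x [^] (c * k) \<otimes> y"
proof -
  have pos: "y \<otimes> x [^] (k::nat) = x [^] (c * int k) \<otimes> y" for k
  proof (induction k)
    case (Suc k)
    have "y \<otimes> x [^] Suc k = x [^] (c * int k) \<otimes> (y \<otimes> x)"
      using Suc assms(1,2) by (simp add: m_assoc[symmetric])
    also have "\<dots> = x [^] (c * int k) \<otimes> x [^] c \<otimes> y"
      using assms(1,2) by (simp add: assms(3) m_assoc)
    also have "\<dots> = x [^] (c * int (Suc k)) \<otimes> y"
      using assms by (simp add: int_pow_mult[symmetric] distrib_left add.commute)
    finally show ?case .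
  qed (use assms in simp)
  show ?thesis
  proof (cases k rule: int_cases2)
    case (nonneg m)
    then show ?thesis using pos[of m] by (simp add: int_pow_int)
  next
    case (nonpos m)
    have "y = x [^] (c * int m) \<otimes> y \<otimes> x [^] (- int m)"
      using assms by (simp add: pos[symmetric] m_assoc int_pow_int[symmetric] int_pow_mult[symmetric])
    then have "x [^] (- (c * int m)) \<otimes> y =
        x [^] (- (c * int m)) \<otimes> (x [^] (c * int m) \<otimes> y \<otimes> x [^] (- int m))"
      by simp
    also have "\<dots> = y \<otimes> x [^] (- int m)"
      using assms by (simp add: m_assoc[symmetric] int_pow_mult[symmetric])
    finally show ?thesis using nonpos by simp
  qed
qed

text \<open>One direction is the invariance of the coordinates. For the other, the relations bring
  every word into a normal form that depends only on the coordinates.\<close>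

lemma word_eq_semidihedral_iff:
  assumes n: "n > 0"
  shows "word_eq (semidihedral_relations n) v w \<longleftrightarrow>
    [a_exp n v = a_exp n w] (mod 4 * int n) \<and> b_odd v = b_odd w"
proof
  let ?R = "semidihedral_relations n"
  let ?G = "presented_group ?R"
  interpret group ?G by (rule group_presented_group)
  let ?cl = "word_class ?R"
  have cl: "?cl w \<in> carrier ?G" for w by (simp add: presented_group_def)
  have one: "\<one>\<^bsub>?G\<^esub> = ?cl []" by (simp add: presented_group_def)
  define a b where "a = ?cl [(gen_a, True)]" and "b = ?cl [(gen_b, True)]"
  have ab [simp]: "a \<in> carrier ?G" "b \<in> carrier ?G" by (simp_all add: a_def b_def cl)
  have pow: "a [^]\<^bsub>?G\<^esub> k = ?cl (replicate k (gen_a, True))" for k :: nat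
    by (induction k) (simp_all add: one a_def mult_word_class replicate_append_same)
  have rel: "?cl l = ?cl r" if "(l, r) \<in> ?R" for l r
    using word_eq.relation[OF that, of "[]" "[]"] by (simp add: word_class_eq_iff)
  have an: "a [^]\<^bsub>?G\<^esub> (4 * n) = \<one>\<^bsub>?G\<^esub>"
    unfolding pow one by (rule rel) (simp add: semidihedral_relations_def Let_def)
  have bb: "b \<otimes>\<^bsub>?G\<^esub> b = \<one>\<^bsub>?G\<^esub>"
    unfolding b_def one mult_word_class by (rule rel) (simp add: semidihedral_relations_def Let_def)
  have "b \<otimes>\<^bsub>?G\<^esub> a = a [^]\<^bsub>?G\<^esub> (2 * n - 1) \<otimes>\<^bsub>?G\<^esub> b"
    unfolding pow unfolding a_def b_def mult_word_class
    by (rule rel) (simp add: semidihedral_relations_def Let_def)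
  then have "b \<otimes>\<^bsub>?G\<^esub> a = a [^]\<^bsub>?G\<^esub> (2 * int n - 1) \<otimes>\<^bsub>?G\<^esub> b"
    using n by (simp add: int_pow_int[symmetric] of_nat_diff)
  note ba = int_pow_commute_twisted[OF ab this]
  have inv: "?cl [(x, False)] = inv\<^bsub>?G\<^esub> (?cl [(x, True)])" for x
    using word_eq.cancel[of ?R "[]" x False "[]"]
    by (intro inv_equality[symmetric] cl) (simp_all add: mult_word_class one word_class_eq_iff)
  have ainv: "?cl [(gen_a, s)] = a [^]\<^bsub>?G\<^esub> (if s then 1 else -1 :: int)" for s
    using inv[of gen_a] by (cases s) (simp_all add: a_def[symmetric] int_pow_neg)
  have binv: "?cl [(gen_b, s)] = b" for s
    using inv[of gen_b] inv_equality[OF bb] by (cases s) (simp_all add: b_def[symmetric])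
  \<comment> \<open>Letters are prepended one at a time; a new \<open>b\<close> is moved past the
    power of \<open>a\<close> by \<open>ba\<close> and then merges with the final factor by
    \<open>bb\<close>.\<close>
  have nf: "?cl w = a [^]\<^bsub>?G\<^esub> a_exp n w \<otimes>\<^bsub>?G\<^esub> (if b_odd w then b else \<one>\<^bsub>?G\<^esub>)" for w
  proof (induction w rule: b_odd.induct)
    case (2 s w)
    have "?cl ((gen_a, s) # w) = ?cl [(gen_a, s)] \<otimes>\<^bsub>?G\<^esub> ?cl w" by (simp add: mult_word_class)
    also have "\<dots> = a [^]\<^bsub>?G\<^esub> a_exp n ((gen_a, s) # w) \<otimes>\<^bsub>?G\<^esub>
        (if b_odd w then b else \<one>\<^bsub>?G\<^esub>)"
      unfolding ainv 2 a_exp.simps by (simp add: int_pow_mult m_assoc del: int_pow_1)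
    finally show ?case by simp
  next
    case (3 s w)
    have "?cl ((gen_b, s) # w) = ?cl [(gen_b, s)] \<otimes>\<^bsub>?G\<^esub> ?cl w" by (simp add: mult_word_class)
    also have "\<dots> = b \<otimes>\<^bsub>?G\<^esub> a [^]\<^bsub>?G\<^esub> a_exp n w \<otimes>\<^bsub>?G\<^esub> (if b_odd w then b else \<one>\<^bsub>?G\<^esub>)"
      unfolding binv 3 by (simp add: m_assoc)
    also have "\<dots> = a [^]\<^bsub>?G\<^esub> a_exp n ((gen_b, s) # w) \<otimes>\<^bsub>?G\<^esub>
        (if b_odd w then \<one>\<^bsub>?G\<^esub> else b)"
      unfolding ba a_exp.simps by (simp add: m_assoc bb)
    finally show ?case by simp
  qed (simp add: one[symmetric])
  assume "[a_exp n v = a_exp n w] (mod 4 * int n) \<and> b_odd v = b_odd w"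
  then have "?cl v = ?cl w"
    unfolding nf[of v] nf[of w] using int_pow_cong[OF ab(1) an, of "a_exp n v" "a_exp n w"] by simp
  then show "word_eq ?R v w" by (simp add: word_class_eq_iff)
qed (use word_eq_a_exp_b_odd[OF n] in blast)

text \<open>
  The class of \<open>a^k b^t\<close>: \<open>0\<close> for the center \<open>{a^(n i)}\<close>, \<open>1\<close> for the rest of \<open>\<langle>a\<rangle>\<close>,
  and \<open>2 + (k mod n)\<close> for the coset of \<open>a^k b\<close> modulo the center.
\<close>

definition sd_label :: "nat \<Rightarrow> int \<Rightarrow> bool \<Rightarrow> nat" where
  "sd_label n k t = (if t then 2 + nat (k mod int n) else if int n dvd k then 0 else 1)"

text \<open>For \<open>n > 0\<close> the choice of \<open>w\<close> does not matter on word classes,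
  because equivalent words have the same reduced coordinates.\<close>

definition sd_coords :: "nat \<Rightarrow> sd_gen word set \<Rightarrow> int \<times> bool" where
  "sd_coords n X = (let w = SOME w. w \<in> X in (a_exp n w mod (4 * int n), b_odd w))"

lemma sd_coords_word_class:
  assumes "n > 0"
  shows "sd_coords n (word_class (semidihedral_relations n) w) =
    (a_exp n w mod (4 * int n), b_odd w)"
proof -
  let ?R = "semidihedral_relations n"
  have "w \<in> word_class ?R w" by (simp add: word_class_def word_eq.refl)
  then have "(SOME v. v \<in> word_class ?R w) \<in> word_class ?R w" by (rule someI)
  then show ?thesis
    using word_eq_semidihedral_iff[OF assms, of w]
    by (simp add: sd_coords_def word_class_def Let_def cong_def)
qed

text \<open>Coordinates separate word classes, and the words \<open>a^k b^t\<close> realize all of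
  them; the order \<open>8n\<close> follows.\<close>

lemma bij_betw_sd_coords:
  assumes n: "n > 0"
  shows "bij_betw (sd_coords n) (carrier (semidihedral_group n)) ({0..<4 * int n} \<times> UNIV)"
  unfolding bij_betw_def
proof
  let ?R = "semidihedral_relations n"
  have c: "carrier (semidihedral_group n) = range (word_class ?R)"
    by (simp add: semidihedral_group_def presented_group_def)
  show "inj_on (sd_coords n) (carrier (semidihedral_group n))"
    by (auto simp: c inj_on_def sd_coords_word_class[OF n] word_class_eq_iff
        word_eq_semidihedral_iff[OF n] cong_def)
  show "sd_coords n ` carrier (semidihedral_group n) = {0..<4 * int n} \<times> UNIV"
  proof (intro equalityI subsetI)
    fix p :: "int \<times> bool" assume "p \<in> {0..<4 * int n} \<times> UNIV"
    then obtain k t where p: "p = (k, t)" "0 \<le> k" "k < 4 * int n" by auto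
    define u where "u = replicate (nat k) (gen_a, True)"
    define v where "v = (if t then [(gen_b, True)] else [])"
    have "a_exp n v = 0" "b_odd v = t" "a_exp n u = k" "\<not> b_odd u"
      using p by (simp_all add: u_def v_def a_exp_replicate b_odd_replicate)
    then have "sd_coords n (word_class ?R (u @ v)) = p"
      using a_exp_append[of n u v] p by (simp add: sd_coords_word_class[OF n] b_odd_append cong_def)
    then show "p \<in> sd_coords n ` carrier (semidihedral_group n)" by (auto simp: c)
  qed (use n in \<open>auto simp: c sd_coords_word_class\<close>)
qed

definition sd_class :: "nat \<Rightarrow> sd_gen word set \<Rightarrow> nat" where
  "sd_class n X = case_prod (sd_label n) (sd_coords n X)"

text \<open>The label depends only on the exponent mod \<open>n\<close>, so reducing it mod
  \<open>4n\<close> changes nothing.\<close>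

lemma sd_class_word_class:
  "n > 0 \<Longrightarrow> sd_class n (word_class (semidihedral_relations n) w) = sd_label n (a_exp n w) (b_odd w)"
  by (simp add: sd_class_def sd_coords_word_class sd_label_def mod_mod_cancel dvd_mod_iff)

section \<open>Centralizers in the semidihedral group\<close>

text \<open>The parity of \<open>n\<close> enters here: for \<open>n = 2m + 1\<close> the factor
  \<open>2n - 2\<close> is \<open>4m\<close>, and \<open>m\<close> is coprime to
  \<open>n\<close>.\<close>

lemma dvd_twist_iff:
  assumes "odd n"
  shows "4 * int n dvd (2 * int n - 2) * x \<longleftrightarrow> int n dvd x"
proof -
  obtain m where m: "n = 2 * m + 1" using assms by (auto elim: oddE)
  have "coprime (2 * int m + 1) (int m)"
    by (rule coprimeI) (metis dvd_add_right_iff dvd_mult)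
  then have "int n dvd int m * x \<longleftrightarrow> int n dvd x"
    unfolding m by (simp add: coprime_dvd_mult_right_iff add.commute)
  moreover have "(2 * int n - 2) * x = 4 * (int m * x)" unfolding m by simp
  then have "4 * int n dvd (2 * int n - 2) * x \<longleftrightarrow> int n dvd int m * x"
    by (simp only: dvd_mult_cancel_left) simp
  ultimately show ?thesis by simp
qed

text \<open>Both products have the same \<open>b\<close>-part, so they agree iff their exponents do
  mod \<open>4n\<close>. The difference of the exponents is zero or a multiple of
  \<open>2n - 2\<close>, which reduces commuting to divisibility by \<open>n\<close>.\<close>

lemma commute_semidihedral_iff:
  assumes n: "odd n" and X: "X \<in> carrier (semidihedral_group n)"
    and Y: "Y \<in> carrier (semidihedral_group n)"
  shows "X \<otimes>\<^bsub>semidihedral_group n\<^esub> Y = Y \<otimes>\<^bsub>semidihedral_group n\<^esub> X \<longleftrightarrow>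
    sd_class n X = 0 \<or> sd_class n Y = 0 \<or> sd_class n X = sd_class n Y"
proof -
  let ?R = "semidihedral_relations n"
  have n0: "n > 0" using n by (simp add: odd_pos)
  obtain u v where u: "X = word_class ?R u" and v: "Y = word_class ?R v"
    using X Y by (auto simp: semidihedral_group_def presented_group_def)
  let ?L = "a_exp n u + twist n (b_odd u) * a_exp n v"
    and ?M = "a_exp n v + twist n (b_odd v) * a_exp n u"
  have "X \<otimes>\<^bsub>semidihedral_group n\<^esub> Y = Y \<otimes>\<^bsub>semidihedral_group n\<^esub> X \<longleftrightarrow>
      [a_exp n (u @ v) = a_exp n (v @ u)] (mod 4 * int n)"
    unfolding u v semidihedral_group_def
    by (auto simp: mult_word_class word_class_eq_iff word_eq_semidihedral_iff[OF n0] b_odd_append)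
  also have "\<dots> \<longleftrightarrow> [?L = ?M] (mod 4 * int n)"
    using a_exp_append[of n u v] a_exp_append[of n v u] by (simp add: cong_def)
  also have "\<dots> \<longleftrightarrow> 4 * int n dvd ?M - ?L"
    by (simp add: cong_iff_dvd_diff dvd_diff_commute)
  also have "\<dots> \<longleftrightarrow> sd_label n (a_exp n u) (b_odd u) = 0 \<or>
      sd_label n (a_exp n v) (b_odd v) = 0 \<or>
      sd_label n (a_exp n u) (b_odd u) = sd_label n (a_exp n v) (b_odd v)"
  proof (cases "b_odd u"; cases "b_odd v")
    assume f: "b_odd u" "b_odd v"
    then have "?M - ?L = (2 * int n - 2) * (a_exp n u - a_exp n v)" by (simp add: algebra_simps)
    then show ?thesis
      using f n0 by (simp only: dvd_twist_iff[OF n]) (simp add: sd_label_def mod_eq_dvd_iff eq_nat_nat_iff)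
  next
    assume f: "b_odd u" "\<not> b_odd v"
    then have "?M - ?L = - ((2 * int n - 2) * a_exp n v)" by (simp add: algebra_simps)
    then show ?thesis
      using f by (simp only: dvd_twist_iff[OF n] dvd_minus_iff) (simp add: sd_label_def)
  next
    assume f: "\<not> b_odd u" "b_odd v"
    then have "?M - ?L = (2 * int n - 2) * a_exp n u" by (simp add: algebra_simps)
    then show ?thesis
      using f by (simp only: dvd_twist_iff[OF n]) (simp add: sd_label_def)
  qed (simp add: sd_label_def)
  finally show ?thesis by (simp add: u v sd_class_word_class[OF n0])
qed

lemma card_residue_class:
  assumes "j < n"
  shows "card {k \<in> {0..<4 * int n}. k mod int n = int j} = 4"
proof -
  have "{k \<in> {0..<4 * int n}. k mod int n = int j} = (\<lambda>i. int j + int n * i) ` {0..<4}"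
  proof (intro equalityI subsetI)
    fix k assume k: "k \<in> {k \<in> {0..<4 * int n}. k mod int n = int j}"
    then have "k = int j + int n * (k div int n)"
      by (metis (lifting) add.commute mem_Collect_eq mult_div_mod_eq)
    moreover from this have "int n * (k div int n) < int n * 4"
    proof -
      have "k < 4 * int n" using k by simp
      with \<open>k = int j + int n * (k div int n)\<close> show ?thesis by linarith
    qed
    then have "k div int n < 4" using assms by simp
    ultimately have "k div int n \<in> {0..<4}" "k = int j + int n * (k div int n)"
      using k assms by (simp_all add: pos_imp_zdiv_nonneg_iff)
    then show "k \<in> (\<lambda>i. int j + int n * i) ` {0..<4}" by blast
  next
    fix k assume "k \<in> (\<lambda>i. int j + int n * i) ` {0..<4}"
    then obtain i where i: "0 \<le> i" "i \<le> 3" "k = int j + int n * i" by auto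
    then have "int n * i \<le> int n * 3" by (intro mult_left_mono) auto
    then have "k < 4 * int n" using i assms by linarith
    with i assms show "k \<in> {k \<in> {0..<4 * int n}. k mod int n = int j}" by simp
  qed
  moreover have "inj_on (\<lambda>i. int j + int n * i) {0..<4}"
    using assms by (auto simp: inj_on_def)
  ultimately show ?thesis by (simp add: card_image)
qed

lemma card_sd_class:
  assumes n: "n > 0" and l: "l < n + 2"
  shows "card {X \<in> carrier (semidihedral_group n). sd_class n X = l} =
    (if l = 1 then 4 * (n - 1) else 4)"
proof -
  let ?P = "{0..<4 * int n}"
  let ?A = "{X \<in> carrier (semidihedral_group n). sd_class n X = l}"
  let ?B = "{p \<in> ?P \<times> UNIV. case_prod (sd_label n) p = l}"
  have "sd_coords n ` ?A = ?B"
    unfolding bij_betw_imp_surj_on[OF bij_betw_sd_coords[OF n], symmetric] sd_class_def by blast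
  then have "bij_betw (sd_coords n) ?A ?B"
    by (intro bij_betw_subset[OF bij_betw_sd_coords[OF n]]) auto
  then have "card ?A = card ?B" by (rule bij_betw_same_card)
  moreover have "card ?B = (if l = 1 then 4 * (n - 1) else 4)"
  proof -
    have z: "card {k \<in> ?P. int n dvd k} = 4"
      using card_residue_class[of 0 n] n by (simp add: dvd_eq_mod_eq_0)
    consider "l = 0" | "l = 1" | "l \<ge> 2" by linarith
    then show ?thesis
    proof cases
      case 1
      then have "?B = {k \<in> ?P. int n dvd k} \<times> {False}" by (auto simp: sd_label_def split: if_splits)
      then show ?thesis using 1 z by (simp add: card_cartesian_product)
    next
      case 2
      then have "?B = (?P - {k \<in> ?P. int n dvd k}) \<times> {False}"
        by (auto simp: sd_label_def split: if_splits)
      moreover have "card (?P - {k \<in> ?P. int n dvd k}) = 4 * n - 4"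
        using z by (subst card_Diff_subset) (auto intro: finite_subset[of _ ?P])
      ultimately show ?thesis using 2 by (simp add: card_cartesian_product diff_mult_distrib2)
    next
      case 3
      then have "?B = {k \<in> ?P. k mod int n = int (l - 2)} \<times> {True}"
        using n by (auto simp: sd_label_def split: if_splits)
      then show ?thesis using 3 l card_residue_class[of "l - 2" n]
        by (simp add: card_cartesian_product)
    qed
  qed
  ultimately show ?thesis by simp
qed

text \<open>All \<open>n + 2\<close> labels occur because no class is empty; \<open>n > 1\<close>
  ensures this for class 1, of size \<open>4(n - 1)\<close>.\<close>

lemma sd_class_image:
  assumes "n > 1"
  shows "sd_class n ` carrier (semidihedral_group n) = {..<n + 2}"
proof (intro equalityI subsetI)
  fix l assume "l \<in> {..<n + 2}"
  then have "card {X \<in> carrier (semidihedral_group n). sd_class n X = l} \<noteq> 0"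
    using assms by (simp add: card_sd_class)
  then have "{X \<in> carrier (semidihedral_group n). sd_class n X = l} \<noteq> {}" by (metis card.empty)
  then show "l \<in> sd_class n ` carrier (semidihedral_group n)" by auto
next
  fix l assume "l \<in> sd_class n ` carrier (semidihedral_group n)"
  moreover have "sd_label n k t < n + 2" for k t
    using assms by (simp add: sd_label_def nat_less_iff)
  ultimately show "l \<in> {..<n + 2}" by (auto simp: sd_class_def split: prod.split)
qed

lemma card_semidihedral_group:
  assumes "n > 0"
  shows "card (carrier (semidihedral_group n)) = 8 * n"
  using bij_betw_same_card[OF bij_betw_sd_coords[OF assms]]
  by (simp add: card_cartesian_product UNIV_bool)

lemma centralizer_classes_semidihedral:
  assumes n: "n > 1" "odd n"
  shows "centralizer_classes (semidihedral_group n) (sd_class n)"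
proof
  let ?C = "carrier (semidihedral_group n)"
  note image = sd_class_image[OF n(1)]
  show fin: "finite ?C"
    using card_semidihedral_group[of n] n by (intro card_ge_0_finite) simp
  show "0 \<in> sd_class n ` ?C" by (simp add: image)
  show "\<exists>Y\<in>?C. Y \<noteq> X \<and> sd_class n Y = sd_class n X" if X: "X \<in> ?C" for X
  proof (rule ccontr)
    let ?F = "{Y \<in> ?C. sd_class n Y = sd_class n X}"
    assume "\<not> ?thesis"
    then have "?F = {X}" using X by auto
    then have "card ?F = 1" by simp
    moreover have "sd_class n X < n + 2" using X image by blast
    ultimately show False using n by (simp add: card_sd_class split: if_splits)
  qed
  show "\<exists>X\<in>?C. sd_class n X \<noteq> 0 \<and> sd_class n X \<noteq> l" for l
  proof -
    \<comment> \<open>Labels 1 and 2 are both noncentral, and at least one of them differs from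
      \<open>l\<close>.\<close>
    have "(if l = 1 then 2 else 1) \<in> sd_class n ` ?C" using n by (simp add: image)
    then show ?thesis by (force split: if_splits)
  qed
qed (use commute_semidihedral_iff n in blast)

section \<open>The resolving polynomial\<close>

text \<open>Class 1 is the exceptional index, and the other \<open>n + 1\<close> classes have size
  4. Writing the size of the complement as \<open>Suc k\<close> avoids a truncated subtraction in
  the second binomial.\<close>

lemma resolving_count_semidihedral:
  assumes n: "n > 1" "odd n"
  shows "resolving_count (commuting_graph (semidihedral_group n)) (8 * n) = 1"
    and "k < 8 * n \<Longrightarrow> int (resolving_count (commuting_graph (semidihedral_group n)) (8 * n - Suc k)) =
      4 ^ Suc k * (int ((n + 1) choose Suc k) + (int n - 1) * int ((n + 1) choose k))"
proof -
  interpret centralizer_classes "semidihedral_group n" "sd_class n"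
    by (rule centralizer_classes_semidihedral[OF n])
  let ?C = "carrier (semidihedral_group n)" and ?G = "commuting_graph (semidihedral_group n)"
  let ?m = "\<lambda>l. card {X \<in> ?C. sd_class n X = l}"
  have c: "card ?C = 8 * n" using n by (simp add: card_semidihedral_group)
  note image = sd_class_image[OF n(1)]
  \<comment> \<open>An empty complement leaves only the whole vertex set.\<close>
  have "{S. S \<subseteq> {..<n + 2} \<and> card S = 0} = {{}}" by (auto dest: finite_subset)
  then show "resolving_count ?G (8 * n) = 1"
    using resolving_count[of 0] by (simp add: c image)
  assume k: "k < 8 * n"
  define L where "L = {..<n + 2} - {1}"
  have L: "{..<n + 2} = insert 1 L" "finite L" "1 \<notin> L" "card L = n + 1" by (auto simp: L_def)
  have "resolving_count ?G (8 * n - Suc k) =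
      (\<Sum>S | S \<subseteq> insert 1 L \<and> card S = Suc k. \<Prod>l\<in>S. ?m l)"
    using resolving_count[of "Suc k"] k unfolding c image L(1) by simp
  also have "\<dots> = 4 ^ Suc k * of_nat (card L choose Suc k) + ?m 1 * 4 ^ k * of_nat (card L choose k)"
    using n by (intro sum_prod_subsets_Suc[OF L(2,3)]) (simp add: card_sd_class L_def)
  also have "\<dots> = 4 ^ Suc k * ((n + 1) choose Suc k) + 4 * (n - 1) * 4 ^ k * ((n + 1) choose k)"
    using n by (simp add: card_sd_class L(4))
  finally have "resolving_count ?G (8 * n - Suc k) =
      4 ^ Suc k * ((n + 1) choose Suc k) + 4 * (n - 1) * 4 ^ k * ((n + 1) choose k)" .
  then have "int (resolving_count ?G (8 * n - Suc k)) =
      4 ^ Suc k * int ((n + 1) choose Suc k) + 4 * int (n - 1) * 4 ^ k * int ((n + 1) choose k)"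
    by simp
  also have "int (n - 1) = int n - 1" using n by simp
  finally show "int (resolving_count ?G (8 * n - Suc k)) =
      4 ^ Suc k * (int ((n + 1) choose Suc k) + (int n - 1) * int ((n + 1) choose k))"
    by (simp only: power_Suc distrib_left mult_ac)
qed

theorem theorem4p28:
  fixes n :: nat
  assumes "n \<ge> 3" and "odd n"
  shows "resolving_polynomial (commuting_graph (semidihedral_group n)) =
           monom 1 (8 * n) + monom (8 * int n) (8 * n - 1)
           + monom (2 ^ (2 * n + 4) * (int n - 1)) (7 * n - 2)
           + (\<Sum>i = 7 * n - 1..8 * n - 2.
                monom (int (resolving_count (commuting_graph (semidihedral_group n)) i)) i)
         \<and> (\<forall>i\<in>{7 * n - 1..8 * n - 2}.
              int (resolving_count (commuting_graph (semidihedral_group n)) i) =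
                2 ^ (16 * n - 2 * i)
                * (int ((n + 1) choose (8 * n - i))
                   + (int n - 1) * int ((n + 1) choose (8 * n - i - 1))))"
proof (intro conjI ballI)
  let ?\<Gamma> = "commuting_graph (semidihedral_group n)"
  let ?r = "\<lambda>i. int (resolving_count ?\<Gamma> i)"
  have n: "n > 1" using assms by simp
  interpret centralizer_classes "semidihedral_group n" "sd_class n"
    by (rule centralizer_classes_semidihedral[OF n assms(2)])
  note count = resolving_count_semidihedral[OF n assms(2)]
  have card: "card (pverts ?\<Gamma>) = 8 * n"
    using n card_semidihedral_group[of n] by (simp add: commuting_graph_def)
  have dim: "metric_dimension ?\<Gamma> = 7 * n - 2"
    using n by (simp add: metric_dimension sd_class_image card_semidihedral_group)
  have "{7 * n - 2..8 * n} = {7 * n - 1..8 * n - 2} \<union> {8 * n, 8 * n - 1, 7 * n - 2}"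
    using assms by auto
  then have "resolving_polynomial ?\<Gamma> = (\<Sum>i = 7 * n - 1..8 * n - 2. monom (?r i) i) +
      (\<Sum>i\<in>{8 * n, 8 * n - 1, 7 * n - 2}. monom (?r i) i)"
    unfolding resolving_polynomial_def card dim
    using assms by (simp only:) (intro sum.union_disjoint, auto)
  also have "(\<Sum>i\<in>{8 * n, 8 * n - 1, 7 * n - 2}. monom (?r i) i) =
      monom (?r (8 * n)) (8 * n) + monom (?r (8 * n - 1)) (8 * n - 1) +
      monom (?r (7 * n - 2)) (7 * n - 2)"
  proof -
    have "8 * n \<noteq> 8 * n - 1" "8 * n \<noteq> 7 * n - 2" "8 * n - 1 \<noteq> 7 * n - 2" using n by auto
    then show ?thesis by (simp add: add.assoc del: One_nat_def)
  qed
  also have "?r (8 * n) = 1" using count(1) by simp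
  \<comment> \<open>One omitted vertex: \<open>4 ((n + 1) + (n - 1)) = 8n\<close>.\<close>
  also have "?r (8 * n - 1) = 8 * int n" using count(2)[of 0] n by simp
  \<comment> \<open>With \<open>n + 2\<close> omitted vertices the first binomial vanishes and the
    second is 1.\<close>
  also have "?r (7 * n - 2) = 2 ^ (2 * n + 4) * (int n - 1)"
  proof -
    have "(2 :: int) ^ (2 * n + 4) = 4 ^ Suc (n + 1)"
      by (simp add: power_add power_mult)
    moreover have "8 * n - Suc (n + 1) = 7 * n - 2" by simp
    ultimately show ?thesis using count(2)[of "n + 1"] n by (simp del: binomial_Suc_Suc)
  qed
  finally show "resolving_polynomial ?\<Gamma> =
      monom 1 (8 * n) + monom (8 * int n) (8 * n - 1)
      + monom (2 ^ (2 * n + 4) * (int n - 1)) (7 * n - 2)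
      + (\<Sum>i = 7 * n - 1..8 * n - 2. monom (?r i) i)"
    by (simp add: algebra_simps)
  fix i assume i: "i \<in> {7 * n - 1..8 * n - 2}"
  \<comment> \<open>The complement has \<open>Suc k\<close> elements; \<open>i\<close> is at most
    \<open>8n - 2\<close>, so the subtractions are exact, and \<open>4^(k + 1)\<close> becomes
    \<open>2^(16n - 2i)\<close>.\<close>
  define k where "k = 8 * n - i - 1"
  have k: "k < 8 * n" "i = 8 * n - Suc k" "16 * n - 2 * i = 2 * Suc k" "8 * n - i = Suc k"
    using i assms by (auto simp: k_def)
  show "?r i = 2 ^ (16 * n - 2 * i) * (int ((n + 1) choose (8 * n - i))
      + (int n - 1) * int ((n + 1) choose (8 * n - i - 1)))"
    unfolding k(3,4) using count(2)[OF k(1)] by (simp add: k(2)[symmetric] power_mult)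
qed

end
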